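(* Let $P$ be a polytope such that its slack matrix $S(P)$ is a $0/1$ matrix. Then $\operatorname{xc}_{\mathrm{SDP}}(P)\leqslant\dim(P)+2$.
   Context: Slack matrix: for a polytope $P=\{x\in\mathbb{R}^d\mid Ax\leqslant b\}=\operatorname{conv}(V)$ with $V=\{v_1,\ldots,v_n\}$, the slack matrix of $P$ w.r.t. $Ax\leqslant b$ and $V$ has entries $S_{ij}=b_i-A_iv_j$, where $A_i$ is the $i$th row of $A$. $S(P)$ denotes the submatrix whose rows correspond to the facets of $P$ (one facet-defining inequality per facet) and whose columns correspond to the vertices of $P$; since a facet-defining inequality may be scaled by a positive number, the hypothesis is that $S(P)$ is $0/1$ for some choice of facet-defining inequalities. $\dim(P)$ is the dimension of the affine hull of $P$. $\mathbb{S}^r_+$ is the cone of $r\times r$ real symmetric positive semidefinite matrices, embedded in $\mathbb{R}^{r(r+1)/2}$ in such a way that the scalar product of two elements equals the Frobenius product of the corresponding matrices. A semidefinite extended formulation of size $r$ of a polytope $P\subseteq\mathbb{R}^d$ is a system $Ex+Fy=g,\ y\in\mathbb{S}^r_+$ (with real matrices $E,F$ and real vector $g$) such that $P=\{x\in\mathbb{R}^d\mid\exists y:\ Ex+Fy=g,\ y\in\mathbb{S}^r_+\}$. The semidefinite extension complexity $\operatorname{xc}_{\mathrm{SDP}}(P)$ is the minimum $r$ such that $P$ has a semidefinite extended formulation of size $r$. *)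

theory Defs
  imports
    "HOL-Analysis.Analysis"
    "HOL-Library.Extended_Nat"
    "Jordan_Normal_Form.Matrix"
begin

no_notation scalar_prod (infix "\<bullet>" 70)

section \<open>Slack matrices\<close>

definition slack_matrix ::
    "('i \<Rightarrow> 'a::real_inner) \<Rightarrow> ('i \<Rightarrow> real) \<Rightarrow> ('j \<Rightarrow> 'a) \<Rightarrow> 'i \<Rightarrow> 'j \<Rightarrow> real" where
  "slack_matrix A b v i j = b i - A i \<bullet> v j"

text \<open>For a polytope that is not full-dimensional, the inequality is not unique up to scaling.\<close>

definition facet_defining ::
    "'a::euclidean_space set \<Rightarrow> 'a set \<Rightarrow> 'a \<Rightarrow> real \<Rightarrow> bool" where
  "facet_defining P F a \<beta> \<longleftrightarrow>
     F facet_of P \<and> (\<forall>x\<in>P. a \<bullet> x \<le> \<beta>) \<and> F = P \<inter> {x. a \<bullet> x = \<beta>}"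

section \<open>The positive semidefinite cone\<close>

definition psd_mats :: "nat \<Rightarrow> real mat set" where
  "psd_mats r = {Y \<in> carrier_mat r r.
     transpose_mat Y = Y \<and> (\<forall>v\<in>carrier_vec r. 0 \<le> scalar_prod v (Y *\<^sub>v v))}"

definition lower_indices :: "nat \<Rightarrow> (nat \<times> nat) list" where
  "lower_indices r = [(i, j). i \<leftarrow> [0..<r], j \<leftarrow> [0..<Suc i]]"

text \<open>
  The embedding of the symmetric matrices into the space of dimension \<open>r * (r + 1) div 2\<close>. The
  factor \<open>sqrt 2\<close> turns the Frobenius product into the scalar product, see \<open>scalar_prod_svec\<close>.
\<close>

definition svec :: "nat \<Rightarrow> real mat \<Rightarrow> real Matrix.vec" where
  "svec r Y = vec_of_list
     (map (\<lambda>(i, j). if i = j then Y $$ (i, j) else sqrt 2 * Y $$ (i, j)) (lower_indices r))"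

definition psd_cone :: "nat \<Rightarrow> real Matrix.vec set" where
  "psd_cone r = svec r ` psd_mats r"

lemma length_lower_indices: "length (lower_indices r) = r * (r + 1) div 2"
proof (induction r)
  case (Suc r)
  then show ?case by (simp add: lower_indices_def)
qed (simp add: lower_indices_def)

lemma svec_carrier: "svec r Y \<in> carrier_vec (r * (r + 1) div 2)"
  unfolding svec_def by (rule carrier_vecI) (simp add: length_lower_indices)

lemma scalar_prod_map:
  fixes f g :: "'b \<Rightarrow> real"
  shows "scalar_prod (vec_of_list (map f xs)) (vec_of_list (map g xs)) = (\<Sum>x\<leftarrow>xs. f x * g x)"
  by (simp add: scalar_prod_def vec_of_list_index sum_list_sum_nth)

lemma sum_list_lower_indices:
  fixes h :: "nat \<times> nat \<Rightarrow> real"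
  shows "(\<Sum>p\<leftarrow>lower_indices r. h p) = (\<Sum>i<r. \<Sum>j<Suc i. h (i, j))"
proof (induction r)
  case (Suc r)
  have "(\<Sum>j\<leftarrow>[0..<n]. h (r, j)) = (\<Sum>j<n. h (r, j))" for n
    by (simp add: interv_sum_list_conv_sum_set_nat atLeast0LessThan)
  with Suc show ?case by (simp add: lower_indices_def comp_def)
qed (simp add: lower_indices_def)

lemma scalar_prod_svec:
  assumes "Y \<in> carrier_mat r r" "Z \<in> carrier_mat r r" "transpose_mat Y = Y" "transpose_mat Z = Z"
  shows "scalar_prod (svec r Y) (svec r Z) = (\<Sum>i<r. \<Sum>j<r. Y $$ (i, j) * Z $$ (i, j))"
proof -
  define c where "c i j = Y $$ (i, j) * Z $$ (i, j)" for i j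
  have sym: "c i j = c j i" if "i < r" "j < r" for i j
    unfolding c_def using assms that by (metis carrier_matD index_transpose_mat(1))
  have "scalar_prod (svec r Y) (svec r Z) = (\<Sum>i<r. \<Sum>j<Suc i. if i = j then c i j else 2 * c i j)"
    unfolding svec_def scalar_prod_map sum_list_lower_indices
    by (intro sum.cong refl) (auto simp: c_def)
  also have "\<dots> = (\<Sum>i<r. c i i + 2 * (\<Sum>j<i. c i j))"
    by (intro sum.cong refl) (simp add: sum_distrib_left)
  also have "\<dots> = (\<Sum>i<r. \<Sum>j<r. c i j)"
  proof -
    have "m \<le> r \<Longrightarrow> (\<Sum>i<m. c i i + 2 * (\<Sum>j<i. c i j)) = (\<Sum>i<m. \<Sum>j<m. c i j)" for m
    proof (induction m)
      case (Suc m)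
      have "(\<Sum>i<m. c i m) = (\<Sum>i<m. c m i)"
        using Suc.prems by (intro sum.cong refl sym) auto
      with Suc show ?case by (simp add: sum.distrib)
    qed simp
    then show ?thesis by simp
  qed
  finally show ?thesis by (simp add: c_def)
qed

section \<open>Semidefinite extended formulations\<close>

text \<open>\<open>E k\<close> is row \<open>k\<close> of the matrix \<open>E\<close>; there are \<open>m\<close> equations.\<close>

definition is_sdp_ef ::
    "nat \<Rightarrow> nat \<Rightarrow> (nat \<Rightarrow> real^'n) \<Rightarrow> real mat \<Rightarrow> real Matrix.vec \<Rightarrow> (real^'n) set \<Rightarrow> bool" where
  "is_sdp_ef r m E F g P \<longleftrightarrow>
     F \<in> carrier_mat m (r * (r + 1) div 2) \<and> g \<in> carrier_vec m \<and>
     P = {x. \<exists>y\<in>psd_cone r. Matrix.vec m (\<lambda>k. E k \<bullet> x) + F *\<^sub>v y = g}"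

definition has_sdp_ef :: "nat \<Rightarrow> (real^'n) set \<Rightarrow> bool" where
  "has_sdp_ef r P \<longleftrightarrow> (\<exists>m E F g. is_sdp_ef r m E F g P)"

text \<open>
  In \<open>enat\<close> the infimum of a nonempty set is its minimum, and it is \<open>\<infinity>\<close> for the empty set; hence a
  finite upper bound includes the existence of a formulation.
\<close>

definition xc_SDP :: "(real^'n) set \<Rightarrow> enat" where
  "xc_SDP P = (INF r \<in> {r. has_sdp_ef r P}. enat r)"

end

(*
A 0/1 matrix equals its entrywise square. Express the points of the affine hull of P in terms of
an affine basis with d + 1 elements, d = dim P. The slack of a vertex v at a facet F is then the
inner product of the vector c_F of the slacks of the basis points with the coordinate vector u_v,
and since it is 0 or 1 it equals (c_F . u_v)^2 = c_F^T (u_v u_v^T) c_F. Hence P is the set of all x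
in its affine hull such that some positive semidefinite Y of size d + 1 satisfies
b_F - A_F x = c_F^T Y c_F for all facets F: the vertices have the witness u_v u_v^T, and the set is
convex; conversely these equations make all slacks of x nonnegative.
*)
theory Submission
  imports Defs
begin

section \<open>Quadratic forms of positive semidefinite matrices\<close>

text \<open>This is c^T Y c. Taking \<open>c\<close> as a function on \<open>nat\<close> avoids
  dimension conditions; only its values below \<open>r\<close> enter.\<close>

definition quad_form :: "nat \<Rightarrow> real mat \<Rightarrow> (nat \<Rightarrow> real) \<Rightarrow> real" where
  "quad_form r Y c = (\<Sum>i<r. \<Sum>j<r. c i * c j * Y $$ (i, j))"

definition rank_one_mat :: "nat \<Rightarrow> (nat \<Rightarrow> real) \<Rightarrow> real mat" where
  "rank_one_mat r c = mat r r (\<lambda>(i, j). c i * c j)"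

lemma scalar_prod_eq_quad_form:
  assumes "Y \<in> carrier_mat r r" "v \<in> carrier_vec r"
  shows "scalar_prod v (Y *\<^sub>v v) = quad_form r Y (vec_index v)"
  using assms
  by (auto simp: scalar_prod_def quad_form_def sum_distrib_left mult_ac atLeast0LessThan
      intro!: sum.cong)

lemma psd_mats_quad_form:
  "Y \<in> psd_mats r \<longleftrightarrow>
     Y \<in> carrier_mat r r \<and> transpose_mat Y = Y \<and> (\<forall>c. 0 \<le> quad_form r Y c)"
proof -
  have "(\<forall>v\<in>carrier_vec r. 0 \<le> quad_form r Y (vec_index v)) \<longleftrightarrow> (\<forall>c. 0 \<le> quad_form r Y c)"
  proof safe
    fix c assume *: "\<forall>v\<in>carrier_vec r. 0 \<le> quad_form r Y (vec_index v)"
    \<comment> \<open>Truncating \<open>c\<close> to a vector of length \<open>r\<close> does not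
      change the form, so quantifying over functions or over vectors is the same.\<close>
    have "quad_form r Y (vec_index (Matrix.vec r c)) = quad_form r Y c"
      by (simp add: quad_form_def)
    with * show "0 \<le> quad_form r Y c" by (metis vec_carrier)
  qed auto
  then show ?thesis
    by (auto simp: psd_mats_def scalar_prod_eq_quad_form)
qed

lemma quad_form_rank_one_mat: "quad_form r (rank_one_mat r u) c = (\<Sum>i<r. c i * u i)\<^sup>2"
  by (simp add: quad_form_def rank_one_mat_def power2_eq_square sum_product mult_ac)

lemma rank_one_mat_psd: "rank_one_mat r u \<in> psd_mats r"
  unfolding psd_mats_quad_form quad_form_rank_one_mat
  by (auto simp: rank_one_mat_def intro!: eq_matI)

text \<open>For fixed \<open>c\<close> the form is linear in the matrix. This will make the set
  described by the formulation convex.\<close>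

lemma quad_form_lincomb:
  assumes "Y \<in> carrier_mat r r" "Z \<in> carrier_mat r r"
  shows "quad_form r (s \<cdot>\<^sub>m Y + t \<cdot>\<^sub>m Z) c = s * quad_form r Y c + t * quad_form r Z c"
  using assms
  by (simp add: quad_form_def sum_distrib_left algebra_simps sum.distrib)

lemma psd_mats_lincomb:
  assumes "Y \<in> psd_mats r" "Z \<in> psd_mats r" "0 \<le> s" "0 \<le> t"
  shows "s \<cdot>\<^sub>m Y + t \<cdot>\<^sub>m Z \<in> psd_mats r"
proof -
  have Y: "Y \<in> carrier_mat r r" "transpose_mat Y = Y"
    and Z: "Z \<in> carrier_mat r r" "transpose_mat Z = Z"
    using assms by (auto simp: psd_mats_quad_form)
  have sym: "Y $$ (i, j) = Y $$ (j, i)" "Z $$ (i, j) = Z $$ (j, i)" if "i < r" "j < r" for i j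
    using Y Z that by (metis carrier_matD index_transpose_mat(1))+
  show ?thesis
    unfolding psd_mats_quad_form
  proof (intro conjI allI)
    show "transpose_mat (s \<cdot>\<^sub>m Y + t \<cdot>\<^sub>m Z) = s \<cdot>\<^sub>m Y + t \<cdot>\<^sub>m Z"
      using Y(1) Z(1) sym by (intro eq_matI) auto
    show "0 \<le> quad_form r (s \<cdot>\<^sub>m Y + t \<cdot>\<^sub>m Z) c" for c
      using assms by (auto simp: quad_form_lincomb[OF Y(1) Z(1)] psd_mats_quad_form)
  qed (use Y Z in auto)
qed

text \<open>The Frobenius product of c c^T with Y is c^T Y c. Thus the form, quadratic in
  \<open>c\<close>, is a linear functional of the embedded matrix and can serve as a row of
  \<open>F\<close>.\<close>

lemma scalar_prod_svec_rank_one_mat: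
  assumes "Y \<in> psd_mats r"
  shows "scalar_prod (svec r (rank_one_mat r c)) (svec r Y) = quad_form r Y c"
proof -
  have "scalar_prod (svec r (rank_one_mat r c)) (svec r Y)
      = (\<Sum>i<r. \<Sum>j<r. rank_one_mat r c $$ (i, j) * Y $$ (i, j))"
    using assms rank_one_mat_psd[of r c] by (intro scalar_prod_svec) (auto simp: psd_mats_def)
  then show ?thesis
    by (simp add: quad_form_def rank_one_mat_def)
qed

section \<open>From equations with quadratic forms to extended formulations\<close>

text \<open>Each triple yields one row of the system: \<open>a\<close> goes into \<open>E\<close>,
  the embedded rank-one matrix of \<open>c\<close> into \<open>F\<close>, and \<beta> into
  \<open>g\<close>.\<close>

lemma has_sdp_ef_quad_form:
  fixes T :: "((real^'n) \<times> real \<times> (nat \<Rightarrow> real)) set"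
  assumes "finite T"
  shows "has_sdp_ef r {x. \<exists>Y\<in>psd_mats r. \<forall>(a, \<beta>, c)\<in>T. a \<bullet> x + quad_form r Y c = \<beta>}"
proof -
  obtain ts where ts: "set ts = T"
    using finite_list[OF assms] by blast
  define m where "m = length ts"
  define E where "E k = fst (ts ! k)" for k
  define F where
    "F = mat_of_rows (r * (r + 1) div 2) (map (\<lambda>(a, \<beta>, c). svec r (rank_one_mat r c)) ts)"
  define g where "g = vec_of_list (map (\<lambda>(a, \<beta>, c). \<beta>) ts)"
  have F: "F \<in> carrier_mat m (r * (r + 1) div 2)"
    unfolding F_def m_def by auto
  have g: "g \<in> carrier_vec m"
    unfolding g_def m_def by (intro carrier_vecI) simp
  have eq: "Matrix.vec m (\<lambda>k. E k \<bullet> x) + F *\<^sub>v svec r Y = g \<longleftrightarrow>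
      (\<forall>(a, \<beta>, c)\<in>T. a \<bullet> x + quad_form r Y c = \<beta>)" if Y: "Y \<in> psd_mats r" for x Y
  proof -
    have entry: "vec_index (Matrix.vec m (\<lambda>k. E k \<bullet> x) + F *\<^sub>v svec r Y) k
        = fst (ts ! k) \<bullet> x + quad_form r Y (snd (snd (ts ! k)))" if k: "k < m" for k
    proof -
      have "row F k = svec r (rank_one_mat r (snd (snd (ts ! k))))"
        using k svec_carrier unfolding F_def m_def
        by (subst mat_of_rows_row) (auto simp: case_prod_beta)
      then show ?thesis
        using k F by (simp add: E_def scalar_prod_svec_rank_one_mat[OF Y])
    qed
    have "Matrix.vec m (\<lambda>k. E k \<bullet> x) + F *\<^sub>v svec r Y = g \<longleftrightarrow>
        (\<forall>k<m. fst (ts ! k) \<bullet> x + quad_form r Y (snd (snd (ts ! k))) = vec_index g k)"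
      using F g entry by (auto simp: vec_eq_iff)
    also have "\<dots> \<longleftrightarrow>
        (\<forall>k<m. fst (ts ! k) \<bullet> x + quad_form r Y (snd (snd (ts ! k))) = fst (snd (ts ! k)))"
      by (auto simp: g_def m_def vec_of_list_index case_prod_beta)
    also have "\<dots> \<longleftrightarrow> (\<forall>(a, \<beta>, c)\<in>T. a \<bullet> x + quad_form r Y c = \<beta>)"
      unfolding ts[symmetric] m_def by (auto simp: all_set_conv_all_nth case_prod_beta)
    finally show ?thesis .
  qed
  have "is_sdp_ef r m E F g {x. \<exists>Y\<in>psd_mats r. \<forall>(a, \<beta>, c)\<in>T. a \<bullet> x + quad_form r Y c = \<beta>}"
    unfolding is_sdp_ef_def psd_cone_def using F g eq by auto
  then show ?thesis
    unfolding has_sdp_ef_def by blast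
qed

section \<open>Linear description of a polytope\<close>

lemma affine_hull_linear_system:
  fixes S :: "'a::euclidean_space set"
  obtains H :: "('a \<times> real) set" where
    "finite H" "affine hull S = {x. \<forall>(a, \<beta>)\<in>H. a \<bullet> x = \<beta>}"
proof -
  obtain \<F> where \<F>: "finite \<F>" "affine hull S = \<Inter>\<F>"
      "\<And>h. h \<in> \<F> \<Longrightarrow> \<exists>a \<beta>. a \<noteq> 0 \<and> h = {x. a \<bullet> x = \<beta>}"
    using affine_hull_finite_intersection_hyperplanes[of S] by metis
  then obtain a \<beta> where h: "\<And>h. h \<in> \<F> \<Longrightarrow> h = {x. a h \<bullet> x = \<beta> h}"
    by metis
  show thesis
  proof
    show "finite ((\<lambda>h. (a h, \<beta> h)) ` \<F>)"
      using \<F>(1) by simp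
    show "affine hull S = {x. \<forall>(a, \<beta>)\<in>(\<lambda>h. (a h, \<beta> h)) ` \<F>. a \<bullet> x = \<beta>}"
      unfolding \<F>(2) using h by auto
  qed
qed

text \<open>
  A segment from a relatively interior point to a point of the affine hull outside \<open>P\<close> leaves \<open>P\<close>
  through a facet, and beyond that facet its inequality is violated.
\<close>

lemma polytope_eq_facet_inequalities:
  fixes P :: "'a::euclidean_space set"
  assumes P: "polytope P"
    and facets: "\<And>F. F facet_of P \<Longrightarrow> facet_defining P F (A F) (b F)"
  shows "P = {x \<in> affine hull P. \<forall>F. F facet_of P \<longrightarrow> A F \<bullet> x \<le> b F}"
proof (intro equalityI subsetI)
  fix x assume "x \<in> P"
  then show "x \<in> {x \<in> affine hull P. \<forall>F. F facet_of P \<longrightarrow> A F \<bullet> x \<le> b F}"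
    using facets by (auto simp: facet_defining_def hull_inc)
next
  fix x assume "x \<in> {x \<in> affine hull P. \<forall>F. F facet_of P \<longrightarrow> A F \<bullet> x \<le> b F}"
  then have aff: "x \<in> affine hull P" and le: "\<And>F. F facet_of P \<Longrightarrow> A F \<bullet> x \<le> b F"
    by auto
  show "x \<in> P"
  proof (rule ccontr)
    assume x: "x \<notin> P"
    have "P \<noteq> {}" using aff by auto
    then obtain z where z: "z \<in> rel_interior P"
      using rel_interior_eq_empty[OF polytope_imp_convex[OF P]] by auto
    then have zP: "z \<in> P" using rel_interior_subset by blast
    obtain d where d: "0 < d" and front: "z + d *\<^sub>R (x - z) \<in> rel_frontier P"
      using ray_to_rel_frontier[OF polytope_imp_bounded[OF P] z, of "x - z"] aff x zP by auto
    define y where "y = z + d *\<^sub>R (x - z)"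
    \<comment> \<open>The relative frontier of a polyhedron is the union of its facets.\<close>
    obtain F where F: "F facet_of P" "y \<in> F"
      using front rel_frontier_of_polyhedron[OF polytope_imp_polyhedron[OF P]]
      unfolding y_def by auto
    have FP: "F = P \<inter> {x. A F \<bullet> x = b F}" and zle: "A F \<bullet> z \<le> b F"
      using facets[OF F(1)] zP by (auto simp: facet_defining_def)
    \<comment> \<open>A proper face misses the relative interior, so the facet inequality is strict
      at \<open>z\<close>.\<close>
    have "F \<noteq> P" using F(1) by auto
    then have "z \<notin> F"
      using face_of_disjoint_rel_interior[OF facet_of_imp_face_of[OF F(1)]] z by blast
    then have "A F \<bullet> z \<noteq> b F" using FP zP by blast
    with zle have zless: "A F \<bullet> z < b F" by simp
    have yP: "y \<in> P" and Ay: "A F \<bullet> y = b F"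
      using F(2) FP by blast+
    have *: "A F \<bullet> z + d * (A F \<bullet> x - A F \<bullet> z) = b F"
      using Ay by (simp add: y_def algebra_simps)
    \<comment> \<open>Otherwise \<open>x\<close> lies on the segment from \<open>z\<close> to
      \<open>y\<close>, hence in \<open>P\<close> by convexity.\<close>
    have "d < 1"
    proof (rule ccontr)
      assume "\<not> d < 1"
      then have "x = (1 - 1 / d) *\<^sub>R z + (1 / d) *\<^sub>R y"
        using d by (simp add: y_def algebra_simps)
      also have "\<dots> \<in> P"
        using \<open>\<not> d < 1\<close> d by (intro convexD[OF polytope_imp_convex[OF P] zP yP]) auto
      finally show False using x by simp
    qed
    \<comment> \<open>The functional grows along the ray and reaches \<open>b F\<close> already at
      parameter \<open>d\<close>; at \<open>x\<close>, parameter 1, it therefore exceeds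
      \<open>b F\<close>.\<close>
    moreover have "0 < A F \<bullet> x - A F \<bullet> z"
      using * zless d by (smt (verit) mult_nonneg_nonpos)
    ultimately have "d * (A F \<bullet> x - A F \<bullet> z) < A F \<bullet> x - A F \<bullet> z"
      by simp
    with * le[OF F(1)] show False by simp
  qed
qed

section \<open>The formulation for 0/1 slack matrices\<close>

text \<open>The size is the number of points of an affine basis, one less than the bound claimed in
  the end. For empty \<open>P\<close>, \<open>aff_dim P\<close> is -1 and the size is 0.\<close>

lemma has_sdp_ef_zero_one_slack:
  fixes P :: "(real^'n) set"
  assumes P: "polytope P"
    and facets: "\<And>F. F facet_of P \<Longrightarrow> facet_defining P F (A F) (b F)"
    and zero_one: "\<And>F v. F facet_of P \<Longrightarrow> v extreme_point_of P \<Longrightarrow> b F - A F \<bullet> v \<in> {0, 1}"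
  shows "has_sdp_ef (nat (aff_dim P + 1)) P"
proof -
  obtain B where B: "affine hull B = affine hull P" "\<not> affine_dependent B"
      "int (card B) = aff_dim P + 1"
    using aff_dim_basis_exists[of P] by auto
  define r where "r = card B"
  have r: "nat (aff_dim P + 1) = r" using B(3) by (simp add: r_def)
  have finB: "finite B" using aff_independent_finite[OF B(2)] .
  then obtain p where p: "bij_betw p {..<r} B"
    unfolding r_def using ex_bij_betw_nat_finite by (metis atLeast0LessThan)
  \<comment> \<open>The slacks of the basis points, which need not lie in \<open>P\<close>; the
    entries may be negative.\<close>
  define c where "c F k = b F - A F \<bullet> p k" for F k
  obtain H where H: "finite H" "affine hull P = {x. \<forall>(a, \<beta>)\<in>H. a \<bullet> x = \<beta>}"
    using affine_hull_linear_system[of P] .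
  \<comment> \<open>Zero coefficients make the quadratic form vanish, leaving the plain equations of
    the affine hull; for a facet, the form takes the place of the slack.\<close>
  define T where "T = (\<lambda>(a, \<beta>). (a, \<beta>, \<lambda>k::nat. 0::real)) ` H \<union>
      (\<lambda>F. (A F, b F, c F)) ` {F. F facet_of P}"
  define Q where "Q = {x. \<exists>Y\<in>psd_mats r. \<forall>(a, \<beta>, c)\<in>T. a \<bullet> x + quad_form r Y c = \<beta>}"
  have T_iff: "(\<forall>(a, \<beta>, c)\<in>T. a \<bullet> x + quad_form r Y c = \<beta>) \<longleftrightarrow>
      x \<in> affine hull P \<and> (\<forall>F. F facet_of P \<longrightarrow> A F \<bullet> x + quad_form r Y (c F) = b F)" for x Y
    unfolding H(2) T_def by (auto simp: ball_Un quad_form_def case_prod_beta)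
  have "finite T"
    unfolding T_def using H(1) finite_polytope_facets[OF P] by auto
  then have ef: "has_sdp_ef r Q"
    unfolding Q_def by (rule has_sdp_ef_quad_form)
  have "Q \<subseteq> P"
  proof
    fix x assume "x \<in> Q"
    then obtain Y where Y: "Y \<in> psd_mats r" and aff: "x \<in> affine hull P"
      and eq: "\<And>F. F facet_of P \<Longrightarrow> A F \<bullet> x + quad_form r Y (c F) = b F"
      unfolding Q_def T_iff by auto
    have "A F \<bullet> x \<le> b F" if "F facet_of P" for F
    proof -
      have "0 \<le> quad_form r Y (c F)" using Y by (simp add: psd_mats_quad_form)
      with eq[OF that] show ?thesis by linarith
    qed
    with aff show "x \<in> P"
      using polytope_eq_facet_inequalities[OF P facets] by blast
  qed
  moreover have "P \<subseteq> Q"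
  proof -
    \<comment> \<open>Convexity reduces the inclusion to extreme points, since a polytope is the
      convex hull of these.\<close>
    have "convex Q"
    proof (rule convexI)
      fix x y and s t :: real
      assume "x \<in> Q" "y \<in> Q" and st: "0 \<le> s" "0 \<le> t" "s + t = 1"
      then obtain Y Z where Y: "Y \<in> psd_mats r" and Z: "Z \<in> psd_mats r"
        and eqY: "\<forall>(a, \<beta>, c)\<in>T. a \<bullet> x + quad_form r Y c = \<beta>"
        and eqZ: "\<forall>(a, \<beta>, c)\<in>T. a \<bullet> y + quad_form r Z c = \<beta>"
        unfolding Q_def by auto
      have "\<forall>(a, \<beta>, c)\<in>T. a \<bullet> (s *\<^sub>R x + t *\<^sub>R y) + quad_form r (s \<cdot>\<^sub>m Y + t \<cdot>\<^sub>m Z) c = \<beta>"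
      proof clarify
        fix a \<beta> c assume T: "(a, \<beta>, c) \<in> T"
        have "quad_form r (s \<cdot>\<^sub>m Y + t \<cdot>\<^sub>m Z) c = s * quad_form r Y c + t * quad_form r Z c"
          using Y Z by (intro quad_form_lincomb) (auto simp: psd_mats_def)
        then have "a \<bullet> (s *\<^sub>R x + t *\<^sub>R y) + quad_form r (s \<cdot>\<^sub>m Y + t \<cdot>\<^sub>m Z) c
            = s * (a \<bullet> x + quad_form r Y c) + t * (a \<bullet> y + quad_form r Z c)"
          by (simp add: algebra_simps)
        also have "\<dots> = s * \<beta> + t * \<beta>"
          using bspec[OF eqY T] bspec[OF eqZ T] by simp
        also have "\<dots> = \<beta>" using st(3) by (metis distrib_right mult_1)
        finally show "a \<bullet> (s *\<^sub>R x + t *\<^sub>R y) + quad_form r (s \<cdot>\<^sub>m Y + t \<cdot>\<^sub>m Z) c = \<beta>" .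
      qed
      then show "s *\<^sub>R x + t *\<^sub>R y \<in> Q"
        unfolding Q_def using psd_mats_lincomb[OF Y Z st(1,2)] by blast
    qed
    moreover have "v \<in> Q" if v: "v extreme_point_of P" for v
    proof -
      have aff: "v \<in> affine hull P"
        using v by (simp add: extreme_point_of_def hull_inc)
      then obtain w where w: "sum w B = 1" "(\<Sum>q\<in>B. w q *\<^sub>R q) = v"
        unfolding B(1)[symmetric] affine_hull_finite[OF finB] by auto
      define u where "u k = w (p k)" for k
      have u: "(\<Sum>k<r. u k) = 1" "(\<Sum>k<r. u k *\<^sub>R p k) = v"
        using w sum.reindex_bij_betw[OF p, of w] sum.reindex_bij_betw[OF p, of "\<lambda>q. w q *\<^sub>R q"]
        by (simp_all add: u_def)
      have "A F \<bullet> v + quad_form r (rank_one_mat r u) (c F) = b F" if F: "F facet_of P" for F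
      proof -
        have "A F \<bullet> v = (\<Sum>k<r. u k * (A F \<bullet> p k))"
          by (simp add: u(2)[symmetric] inner_sum_right)
        \<comment> \<open>Because the affine coordinates sum to 1, the constant term also splits,
          and the slack of \<open>v\<close> is the combination of the slacks of the basis
          points.\<close>
        moreover have "b F = (\<Sum>k<r. u k * b F)"
          by (simp add: u(1) flip: sum_distrib_right)
        ultimately have "(\<Sum>k<r. c F k * u k) = b F - A F \<bullet> v"
          by (simp add: c_def algebra_simps sum_subtractf)
        \<comment> \<open>The only use of the 0/1 hypothesis: 0 and 1 equal their squares, and the
          form of the rank-one witness is a square.\<close>
        moreover have "(b F - A F \<bullet> v)\<^sup>2 = b F - A F \<bullet> v"
          using zero_one[OF F v] by auto
        ultimately show ?thesis
          by (simp add: quad_form_rank_one_mat)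
      qed
      with aff show ?thesis
        unfolding Q_def T_iff using rank_one_mat_psd[of r u] by blast
    qed
    ultimately have "convex hull {v. v extreme_point_of P} \<subseteq> Q"
      by (intro hull_minimal) auto
    then show ?thesis
      using Krein_Milman_Minkowski[OF polytope_imp_compact[OF P] polytope_imp_convex[OF P]] by simp
  qed
  ultimately show ?thesis
    using ef by (simp add: r)
qed

theorem corollary17:
  fixes P :: "(real^'n) set"
    and A :: "(real^'n) set \<Rightarrow> real^'n"
    and b :: "(real^'n) set \<Rightarrow> real"
  assumes "polytope P"
    and "\<And>F. F facet_of P \<Longrightarrow> facet_defining P F (A F) (b F)"
    and "\<And>F v. F facet_of P \<Longrightarrow> v extreme_point_of P \<Longrightarrow>
           slack_matrix A b (\<lambda>w. w) F v \<in> {0, 1}"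
  shows "xc_SDP P \<le> enat (nat (aff_dim P + 2))"
proof -
  have "has_sdp_ef (nat (aff_dim P + 1)) P"
    using assms unfolding slack_matrix_def by (rule has_sdp_ef_zero_one_slack)
  \<comment> \<open>An infimum is at most each member of its set.\<close>
  then have "xc_SDP P \<le> enat (nat (aff_dim P + 1))"
    unfolding xc_SDP_def by (intro INF_lower) simp
  also have "\<dots> \<le> enat (nat (aff_dim P + 2))"
    by simp
  finally show ?thesis .
qed

end
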